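(* Let $A$ and $B$ be finite subsets of an abelian group. If for some real $\varepsilon>0$ we have $|B|\le(1-\varepsilon)|A|$ and $|B-B|\ge\varepsilon^{-1}|A|$, then $|A+B|\ge |A|+|B|$, and moreover $|A\stackrel{\tau}{+}B|\ge |A|+|B|-2$ for every mapping $\tau\colon B\to A$.
   Context: For subsets $A,B$ of an abelian group, $A+B=\{a+b: a\in A, b\in B\}$ and $B-B=\{b'-b'': b',b''\in B\}$. For a mapping $\tau\colon B\to A$, the restricted sumset is $A\stackrel{\tau}{+}B:=\{a+b: a\in A,\ b\in B,\ a\ne\tau(b)\}$. *)

theory Defs
  imports Complex_Main "HOL-Library.Set_Algebras" "HOL-Library.FuncSet"
begin

text \<open>The sumset is the operation \<open>A + B\<close> of \<open>Set_Algebras\<close>. Since \<open>A - B\<close> on sets is the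
  set-theoretic difference, the algebraic difference set gets its own constant.\<close>

definition diffset :: "'a::ab_group_add set \<Rightarrow> 'a set \<Rightarrow> 'a set" where
  "diffset A B = {a - b | a b. a \<in> A \<and> b \<in> B}"

definition restricted_sumset ::
    "('a::ab_group_add \<Rightarrow> 'a) \<Rightarrow> 'a set \<Rightarrow> 'a set \<Rightarrow> 'a set" where
  "restricted_sumset \<tau> A B = {a + b | a b. a \<in> A \<and> b \<in> B \<and> a \<noteq> \<tau> b}"

end

theory Submission
  imports Defs
begin

text \<open>The numbers \<open>|A \<inter> (d + A)|\<close> sum to at most \<open>|A|\<^sup>2\<close> over all \<open>d\<close>, so by averaging some
  \<open>d = b' - b''\<close> in the difference set of \<open>B\<close> satisfies
  \<open>|A \<inter> (d + A)| \<le> |A|\<^sup>2 / |B - B| \<le> \<epsilon>|A| \<le> |A| - |B|\<close>.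
  The two translates \<open>b' + A\<close> and \<open>b'' + A\<close> alone then cover at least
  \<open>2|A| - (|A| - |B|) = |A| + |B|\<close> elements, and the restriction by \<open>\<tau>\<close> removes at most one
  element from each translate.\<close>

text \<open>A pair \<open>(d, x)\<close> counted on the left can be recovered from
  \<open>(x, x - d)\<close>, which lies in \<open>A \<times> A\<close>.\<close>

lemma sum_card_Int_translate_le:
  fixes A D :: "'a::ab_group_add set"
  assumes "finite A" "finite D"
  shows "(\<Sum>d\<in>D. card (A \<inter> (+) d ` A)) \<le> card A ^ 2"
proof -
  have "(\<Sum>d\<in>D. card (A \<inter> (+) d ` A)) = card (SIGMA d:D. A \<inter> (+) d ` A)"
    using assms by simp
  also have "\<dots> \<le> card (A \<times> A)"
    by (rule card_inj_on_le[where f = "\<lambda>(d, x). (x, x - d)"])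
      (use assms in \<open>auto simp: inj_on_def\<close>)
  also have "\<dots> = card A ^ 2"
    by (simp add: card_cartesian_product power2_eq_square)
  finally show ?thesis .
qed

text \<open>Averaging, with the denominator \<open>card D\<close> cleared to stay in the
  naturals.\<close>

lemma exists_card_Int_translate_le:
  fixes A D :: "'a::ab_group_add set"
  assumes "finite A" "finite D" "D \<noteq> {}"
  shows "\<exists>d\<in>D. card D * card (A \<inter> (+) d ` A) \<le> card A ^ 2"
proof (rule ccontr)
  assume "\<not> ?thesis"
  then have "(\<Sum>d\<in>D. card A ^ 2) < (\<Sum>d\<in>D. card D * card (A \<inter> (+) d ` A))"
    using assms by (intro sum_strict_mono) auto
  also have "\<dots> \<le> card D * card A ^ 2"
    unfolding sum_distrib_left[symmetric]
    by (intro mult_left_mono sum_card_Int_translate_le assms) simp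
  finally show False by simp
qed

lemma finite_diffset:
  assumes "finite A" "finite B"
  shows "finite (diffset A B)"
proof -
  have "diffset A B = (\<lambda>(a, b). a - b) ` (A \<times> B)"
    by (auto simp: diffset_def)
  with assms show ?thesis by simp
qed

lemma card_Un_translates:
  fixes A :: "'a::ab_group_add set"
  assumes "finite A"
  shows "card ((+) b ` A \<union> (+) c ` A) + card (A \<inter> (+) (b - c) ` A) = 2 * card A"
proof -
  have "(+) b ` A \<inter> (+) c ` A = (+) c ` (A \<inter> (+) (b - c) ` A)"
    by (simp add: image_Int image_image add.assoc[symmetric] Int_commute)
  then have "card ((+) b ` A \<inter> (+) c ` A) = card (A \<inter> (+) (b - c) ` A)"
    by (simp add: card_image)
  with card_Un_Int[of "(+) b ` A" "(+) c ` A"] assms show ?thesis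
    by (simp add: card_image)
qed

theorem theorem4:
  fixes A B :: "'a::ab_group_add set" and \<epsilon> :: real
  assumes "finite A" and "finite B"
    and "\<epsilon> > 0"
    and "real (card B) \<le> (1 - \<epsilon>) * real (card A)"
    and "real (card (diffset B B)) \<ge> inverse \<epsilon> * real (card A)"
  shows "card (A + B) \<ge> card A + card B \<and>
    (\<forall>\<tau> \<in> B \<rightarrow> A. int (card (restricted_sumset \<tau> A B)) \<ge> int (card A) + int (card B) - 2)"
proof (cases "A = {}")
  case True
  \<comment> \<open>The upper bound on \<open>card B\<close> forces \<open>B = {}\<close>
    here.\<close>
  then show ?thesis using assms by simp
next
  case False
  define D where "D = diffset B B"
  have A_pos: "card A > 0"
    using False assms(1) by (simp add: card_gt_0_iff)
  have fin_D: "finite D"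
    unfolding D_def using assms(2) by (intro finite_diffset)
  have "0 < inverse \<epsilon> * real (card A)"
    using A_pos assms(3) by simp
  then have "D \<noteq> {}"
    using assms(5) by (auto simp: D_def)
  then obtain d where d: "d \<in> D" and avg: "card D * card (A \<inter> (+) d ` A) \<le> card A ^ 2"
    using exists_card_Int_translate_le[OF assms(1) fin_D] by blast
  define k where "k = card (A \<inter> (+) d ` A)"
  obtain b c where bc: "b \<in> B" "c \<in> B" "d = b - c"
    using d by (auto simp: D_def diffset_def)
  \<comment> \<open>The lower bound on the difference set enters as
    \<open>card A \<le> \<epsilon> * card D\<close>; after \<open>avg\<close>, a factor
    \<open>card A\<close> cancels.\<close>
  have "real (card A) * real k \<le> \<epsilon> * real (card D) * real k"
    using assms(3,5) by (intro mult_right_mono) (auto simp: D_def field_simps)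
  also have "\<dots> \<le> \<epsilon> * real (card A) ^ 2"
    using avg assms(3) unfolding k_def mult.assoc
    by (intro mult_left_mono) (simp_all flip: of_nat_mult of_nat_power)
  finally have "real k \<le> \<epsilon> * real (card A)"
    using A_pos by (simp add: power2_eq_square mult.left_commute[of \<epsilon>])
  then have k_le: "k + card B \<le> card A"
    using assms(4) by (simp add: algebra_simps)
  define U where "U = (+) b ` A \<union> (+) c ` A"
  have U_card: "card A + card B \<le> card U"
    using card_Un_translates[OF assms(1), of b c] k_le bc by (simp add: U_def k_def)
  have fin_AB: "finite (A + B)"
    using assms by (simp add: finite_set_plus)
  have U_sub: "U \<subseteq> A + B"
    using bc by (auto simp: U_def set_plus_def add.commute)
  have "int (card A) + int (card B) - 2 \<le> int (card (restricted_sumset \<tau> A B))" for \<tau>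
  proof -
    let ?R = "restricted_sumset \<tau> A B"
    have "finite ?R"
      by (rule finite_subset[OF _ fin_AB]) (auto simp: restricted_sumset_def set_plus_def)
    \<comment> \<open>In the translate of \<open>A\<close> by \<open>x\<close>, only the sum with
      \<open>a = \<tau> x\<close> can be missing from \<open>?R\<close>.\<close>
    moreover have "x + a \<in> insert (\<tau> x + x) ?R" if "x \<in> B" "a \<in> A" for x a
      using that by (cases "a = \<tau> x") (auto simp: restricted_sumset_def add.commute)
    then have "U \<subseteq> {\<tau> b + b, \<tau> c + c} \<union> ?R"
      using bc by (fastforce simp: U_def)
    ultimately have "card U \<le> card ({\<tau> b + b, \<tau> c + c} \<union> ?R)"
      by (intro card_mono) auto
    also have "\<dots> \<le> card {\<tau> b + b, \<tau> c + c} + card ?R"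
      by (rule card_Un_le)
    \<comment> \<open>The two exceptional sums may coincide, hence only an upper bound.\<close>
    also have "\<dots> \<le> 2 + card ?R"
      using card_insert_le_m1[of 2 "{\<tau> c + c}" "\<tau> b + b"] by simp
    finally show ?thesis using U_card by linarith
  qed
  moreover have "card A + card B \<le> card (A + B)"
    using card_mono[OF fin_AB U_sub] U_card by linarith
  ultimately show ?thesis by blast
qed

end
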